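(* Let $B=B_1 \otimes B_2$ where $B_1,B_2 \in \mathbb{R}^{n \times n}$ are symmetric positive definite matrices, and let $\{P_{ij}\}_{i,j=1}^n$ be the family of preconditioners $P_{ij}=P_{1,i}\otimes P_{2,j}$ constructed from $B$ (as defined in the context). Then: 1. $\Lambda(B, P_{ij}) \subset (0,1]$ for all $i,j=1,\dots,n$; 2. for all $i,j,s,q \in \{1,\dots,n\}$ with $i \geq s$ and $j \geq q$, $\lambda_k(B, P_{sq}) \leq \lambda_k(B, P_{ij})$ for all $k=1,\dots,n^2$; 3. if $B_1$ and $B_2$ are nonnegative, then $\lambda_{n^2}(B, P_{ij})=1$ for all $i,j=1,\dots,n$.
   Context: A matrix is called nonnegative if all its entries are nonnegative. $\otimes$ denotes the Kronecker product of matrices. For symmetric $X, Y \in \mathbb{R}^{N\times N}$ with $Y$ positive definite, the generalized eigenvalues of the pencil $(X,Y)$ are the roots $\lambda$ of $\det(X-\lambda Y)=0$, counted with multiplicity; they are all real and are numbered in ascending order, $\lambda_1(X,Y) \le \dots \le \lambda_N(X,Y)$. $\Lambda(X,Y)$ denotes the set of all generalized eigenvalues of $(X,Y)$. The lumping operator $\mathcal{L} \colon \mathbb{R}^{n \times n} \to \mathbb{R}^{n \times n}$ is defined for $X=(x_{ij})$ by $\mathcal{L}(X)=\operatorname{diag}(d_1,\dots,d_n)$ with $d_i=\sum_{j=1}^n |x_{ij}|$. For a symmetric positive definite $C=(c_{kl}) \in \mathbb{R}^{n\times n}$ and $i \in \{1,\dots,n\}$, split $C=D_i+R_i$, where $D_i$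 consists of all super- and sub-diagonals of $C$ of index smaller than $i$, i.e. $(D_i)_{kl}=c_{kl}$ if $|k-l|<i$ and $(D_i)_{kl}=0$ otherwise, and $R_i=C-D_i$. The $i$th preconditioner constructed from $C$ is $D_i+\mathcal{L}(R_i)$. For $B=B_1\otimes B_2$ and $1\le i,j\le n$, $P_{1,i}$ denotes the $i$th preconditioner constructed from $B_1$, $P_{2,j}$ denotes the $j$th preconditioner constructed from $B_2$, and $P_{ij}=P_{1,i}\otimes P_{2,j} \in \mathbb{R}^{n^2\times n^2}$. *)

theory Defs
  imports
    "Jordan_Normal_Form.Char_Poly"
    "HOL-Library.Multiset"
begin

text \<open>Matrices are those of \<^theory>\<open>Jordan_Normal_Form.Matrix\<close>; rows and columns are
  indexed from 0, so that entry \<open>(k, l)\<close> of the text is entry \<open>(k - 1, l - 1)\<close> here.\<close>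

definition kronecker_mat :: "real mat \<Rightarrow> real mat \<Rightarrow> real mat" where
  "kronecker_mat A B = mat (dim_row A * dim_row B) (dim_col A * dim_col B)
     (\<lambda>(i, j). A $$ (i div dim_row B, j div dim_col B) * B $$ (i mod dim_row B, j mod dim_col B))"

definition nonneg_mat :: "real mat \<Rightarrow> bool" where
  "nonneg_mat A \<longleftrightarrow> (\<forall>a \<in> elements_mat A. 0 \<le> a)"

definition sym_mat :: "real mat \<Rightarrow> bool" where
  "sym_mat A \<longleftrightarrow> transpose_mat A = A"

definition sym_pos_def :: "nat \<Rightarrow> real mat \<Rightarrow> bool" where
  "sym_pos_def n A \<longleftrightarrow> A \<in> carrier_mat n n \<and> sym_mat A \<and>
     (\<forall>v \<in> carrier_vec n. v \<noteq> 0\<^sub>v n \<longrightarrow> 0 < v \<bullet> (A *\<^sub>v v))"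


subsection \<open>Generalized eigenvalues\<close>

definition gen_spectrum :: "real mat \<Rightarrow> real mat \<Rightarrow> real set" where
  "gen_spectrum X Y = {x. det (X - x \<cdot>\<^sub>m Y) = 0}"

text \<open>The polynomial \<open>det (X - t Y)\<close> in the indeterminate \<open>t\<close>.\<close>

definition gen_char_poly :: "real mat \<Rightarrow> real mat \<Rightarrow> real poly" where
  "gen_char_poly X Y =
     det (map_mat (\<lambda>a. [:a:]) X - [:0, 1:] \<cdot>\<^sub>m map_mat (\<lambda>a. [:a:]) Y)"

text \<open>The real roots in ascending order, repeated according to multiplicity. For symmetric \<open>X\<close>
  and symmetric positive definite \<open>Y\<close> of size \<open>N\<close> there are exactly \<open>N\<close> of them, i.e. no root
  is lost by not considering complex ones: see \<open>length_gen_eigenvalues\<close> below.\<close>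

definition gen_eigenvalues :: "real mat \<Rightarrow> real mat \<Rightarrow> real list" where
  "gen_eigenvalues X Y = sorted_list_of_multiset (proots (gen_char_poly X Y))"

text \<open>\<open>k\<close> counts from 1.\<close>

definition gen_eigenvalue :: "nat \<Rightarrow> real mat \<Rightarrow> real mat \<Rightarrow> real" where
  "gen_eigenvalue k X Y = gen_eigenvalues X Y ! (k - 1)"


subsection \<open>Preconditioners\<close>

definition lump :: "real mat \<Rightarrow> real mat" where
  "lump X = mat_diag (dim_row X) (\<lambda>i. \<Sum>j < dim_col X. \<bar>X $$ (i, j)\<bar>)"

definition band_part :: "nat \<Rightarrow> real mat \<Rightarrow> real mat" where
  "band_part i C = mat (dim_row C) (dim_col C)
     (\<lambda>(k, l). if \<bar>int k - int l\<bar> < int i then C $$ (k, l) else 0)"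

definition preconditioner :: "nat \<Rightarrow> real mat \<Rightarrow> real mat" where
  "preconditioner i C = band_part i C + lump (C - band_part i C)"

definition kron_preconditioner :: "real mat \<Rightarrow> real mat \<Rightarrow> nat \<Rightarrow> nat \<Rightarrow> real mat" where
  "kron_preconditioner B\<^sub>1 B\<^sub>2 i j = kronecker_mat (preconditioner i B\<^sub>1) (preconditioner j B\<^sub>2)"


subsection \<open>Well-definedness of the generalized eigenvalues\<close>

lemma poly_gen_char_poly:
  assumes "X \<in> carrier_mat n n" "Y \<in> carrier_mat n n"
  shows "poly (gen_char_poly X Y) x = det (X - x \<cdot>\<^sub>m Y)"
  unfolding gen_char_poly_def
  by (rule poly_det_cong[of _ n]) (use assms in auto)

lemma sym_pos_def_det_nonzero:
  assumes "sym_pos_def n Y"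
  shows "det Y \<noteq> 0"
proof
  assume "det Y = 0"
  with assms obtain v where v: "v \<in> carrier_vec n" "v \<noteq> 0\<^sub>v n" "Y *\<^sub>v v = 0\<^sub>v n"
    unfolding sym_pos_def_def using det_0_iff_vec_prod_zero_field by blast
  with assms have "0 < v \<bullet> 0\<^sub>v n"
    unfolding sym_pos_def_def by metis
  with v show False by simp
qed

lemma gen_char_poly_nonzero:
  assumes "X \<in> carrier_mat n n" "sym_pos_def n Y"
  obtains M where "M \<in> carrier_mat n n" "Y * M = X"
    "gen_char_poly X Y = Polynomial.smult (det (- Y)) (char_poly M)" "det (- Y) \<noteq> 0"
proof -
  have Y: "Y \<in> carrier_mat n n" using assms by (simp add: sym_pos_def_def)
  have dY: "det Y \<noteq> 0" using sym_pos_def_det_nonzero[OF assms(2)] .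
  from det_non_zero_imp_unit[OF Y dY, of "()"] obtain Z
    where Z: "Z \<in> carrier_mat n n" "Y * Z = 1\<^sub>m n"
    unfolding Units_def ring_mat_def by auto
  define M where "M = Z * X"
  have M: "M \<in> carrier_mat n n" using Z assms by (simp add: M_def)
  have YM: "Y * M = X"
    unfolding M_def using assoc_mult_mat[OF Y Z(1) assms(1)] Z(2) assms(1) by simp
  have mY: "- Y \<in> carrier_mat n n" using Y by simp
  have "poly (gen_char_poly X Y) x = poly (Polynomial.smult (det (- Y)) (char_poly M)) x" for x
  proof -
    have cM: "- char_matrix M x \<in> carrier_mat n n" using M by simp
    have d: "dim_col Y = dim_row (char_matrix M x)"
      using Y M by (simp add: char_matrix_def)
    have "(- Y) * (- char_matrix M x) = Y * char_matrix M x"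
      using d by simp
    also have "\<dots> = Y * (M + (- x) \<cdot>\<^sub>m 1\<^sub>m n)"
      using M by (simp add: char_matrix_def)
    also have "\<dots> = X + (- x) \<cdot>\<^sub>m Y"
      using mult_add_distrib_mat[OF Y M, of "(- x) \<cdot>\<^sub>m 1\<^sub>m n"] Y
        mult_smult_distrib[OF Y, of "1\<^sub>m n" n "- x"] YM by simp
    also have "\<dots> = X - x \<cdot>\<^sub>m Y"
      using Y assms(1) by (intro eq_matI) auto
    finally have "det (X - x \<cdot>\<^sub>m Y) = det (- Y) * det (- char_matrix M x)"
      using det_mult[OF mY cM] by simp
    then show ?thesis
      using poly_gen_char_poly[OF assms(1) Y] char_poly_matrix[OF M] by simp
  qed
  then have "gen_char_poly X Y = Polynomial.smult (det (- Y)) (char_poly M)"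
    by (intro poly_ext) auto
  moreover have "det (- Y) \<noteq> 0"
    using det_0_negate[OF Y] dY by simp
  ultimately show ?thesis using that M YM by blast
qed

lemma sym_mat_form_commute:
  assumes "A \<in> carrier_mat n n" "sym_mat A" "u \<in> carrier_vec n" "v \<in> carrier_vec n"
  shows "u \<bullet> (A *\<^sub>v v) = v \<bullet> (A *\<^sub>v u)"
proof -
  have "u \<bullet> (A *\<^sub>v v) = (A *\<^sub>v v) \<bullet> u"
    by (rule comm_scalar_prod[of _ n]) (use assms in auto)
  also have "\<dots> = v \<bullet> (A *\<^sub>v u)"
    using transpose_vec_mult_scalar[OF assms(1,3,4)] assms(2) by (simp add: sym_mat_def)
  finally show ?thesis .
qed

lemma pencil_eigenvalue_real:
  assumes X: "X \<in> carrier_mat n n" "sym_mat X" and Y: "sym_pos_def n Y"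
    and M: "M \<in> carrier_mat n n" "Y * M = X"
    and z: "eigenvalue (map_mat complex_of_real M) z"
  shows "Im z = 0"
proof -
  have Yc: "Y \<in> carrier_mat n n" and Ys: "sym_mat Y" using Y by (auto simp: sym_pos_def_def)
  from z obtain v where v: "v \<in> carrier_vec n" "v \<noteq> 0\<^sub>v n"
    and ev: "map_mat complex_of_real M *\<^sub>v v = z \<cdot>\<^sub>v v"
    unfolding eigenvalue_def eigenvector_def using M by auto
  define x y where "x = map_vec Re v" and "y = map_vec Im v"
  have x: "x \<in> carrier_vec n" and y: "y \<in> carrier_vec n" using v by (auto simp: x_def y_def)
  have comp: "(\<Sum>k<n. complex_of_real (M $$ (i, k)) * v $ k) = z * v $ i" if "i < n" for i
    using arg_cong[OF ev, of "\<lambda>w. w $ i"] that v M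
    by (simp add: scalar_prod_def lessThan_atLeast0)
  have Mx: "M *\<^sub>v x = Re z \<cdot>\<^sub>v x + (- Im z) \<cdot>\<^sub>v y"
  proof (rule eq_vecI)
    fix i assume "i < dim_vec (Re z \<cdot>\<^sub>v x + (- Im z) \<cdot>\<^sub>v y)"
    then have i: "i < n" using y by simp
    show "(M *\<^sub>v x) $ i = (Re z \<cdot>\<^sub>v x + (- Im z) \<cdot>\<^sub>v y) $ i"
      using arg_cong[OF comp[OF i], of Re] i v M
      by (simp add: scalar_prod_def lessThan_atLeast0 x_def y_def)
  qed (use M y in auto)
  have My: "M *\<^sub>v y = Im z \<cdot>\<^sub>v x + Re z \<cdot>\<^sub>v y"
  proof (rule eq_vecI)
    fix i assume "i < dim_vec (Im z \<cdot>\<^sub>v x + Re z \<cdot>\<^sub>v y)"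
    then have i: "i < n" using y by simp
    show "(M *\<^sub>v y) $ i = (Im z \<cdot>\<^sub>v x + Re z \<cdot>\<^sub>v y) $ i"
      using arg_cong[OF comp[OF i], of Im] i v M
      by (simp add: scalar_prod_def lessThan_atLeast0 x_def y_def algebra_simps)
  qed (use M y in auto)
  have form: "w \<bullet> (X *\<^sub>v u) = a * (w \<bullet> (Y *\<^sub>v x)) + b * (w \<bullet> (Y *\<^sub>v y))"
    if "M *\<^sub>v u = a \<cdot>\<^sub>v x + b \<cdot>\<^sub>v y" "u \<in> carrier_vec n" "w \<in> carrier_vec n" for u w a b
  proof -
    have "X *\<^sub>v u = Y *\<^sub>v (M *\<^sub>v u)"
      using assoc_mult_mat_vec[OF Yc M(1) that(2)] M(2) by simp
    also have "\<dots> = a \<cdot>\<^sub>v (Y *\<^sub>v x) + b \<cdot>\<^sub>v (Y *\<^sub>v y)"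
      unfolding that(1)
      using mult_add_distrib_mat_vec[OF Yc, of "a \<cdot>\<^sub>v x" "b \<cdot>\<^sub>v y"]
        mult_mat_vec[OF Yc x, of a] mult_mat_vec[OF Yc y, of b] x y by simp
    finally show ?thesis
      using scalar_prod_add_distrib[OF that(3), of "a \<cdot>\<^sub>v (Y *\<^sub>v x)" "b \<cdot>\<^sub>v (Y *\<^sub>v y)"] Yc x y that(3)
      by simp
  qed
  have "Im z * (x \<bullet> (Y *\<^sub>v x) + y \<bullet> (Y *\<^sub>v y)) = 0"
    using form[OF Mx x y] form[OF My y x] sym_mat_form_commute[OF X x y]
      sym_mat_form_commute[OF Yc Ys x y] by (simp add: algebra_simps)
  moreover have "0 < x \<bullet> (Y *\<^sub>v x) + y \<bullet> (Y *\<^sub>v y)"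
  proof -
    have nn: "0 \<le> w \<bullet> (Y *\<^sub>v w)" if "w \<in> carrier_vec n" for w
      using Y that Yc by (cases "w = 0\<^sub>v n") (auto simp: sym_pos_def_def less_imp_le)
    have "x \<noteq> 0\<^sub>v n \<or> y \<noteq> 0\<^sub>v n"
    proof (rule ccontr)
      assume "\<not> ?thesis"
      then have 0: "x = 0\<^sub>v n" "y = 0\<^sub>v n" by auto
      have "v $ i = 0" if "i < n" for i
        using arg_cong[OF 0(1), of "\<lambda>w. w $ i"] arg_cong[OF 0(2), of "\<lambda>w. w $ i"] that v
        by (simp add: x_def y_def complex_eq_iff)
      with v show False by (metis carrier_vecD eq_vecI index_zero_vec)
    qed
    then show ?thesis
      using nn[OF x] nn[OF y] Y x y unfolding sym_pos_def_def
      by (metis add_nonneg_pos add_pos_nonneg)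
  qed
  ultimately show ?thesis by simp
qed

lemma length_gen_eigenvalues:
  assumes "X \<in> carrier_mat n n" "sym_mat X" "sym_pos_def n Y"
  shows "length (gen_eigenvalues X Y) = n"
proof -
  obtain M where M: "M \<in> carrier_mat n n" "Y * M = X"
    and p: "gen_char_poly X Y = Polynomial.smult (det (- Y)) (char_poly M)" "det (- Y) \<noteq> 0"
    using gen_char_poly_nonzero[OF assms(1,3)] by blast
  let ?M = "map_mat complex_of_real M"
  have Mc: "?M \<in> carrier_mat n n" using M by simp
  obtain as where as: "char_poly ?M = (\<Prod>a\<leftarrow>as. [:- a, 1:])" "length as = n"
    using char_poly_factorized[OF Mc] by blast
  have "Im a = 0" if "a \<in> set as" for a
  proof (rule pencil_eigenvalue_real[OF assms M])
    have "poly (char_poly ?M) a = 0" using that unfolding as(1) by (induct as) auto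
    then show "eigenvalue ?M a" using eigenvalue_root_char_poly[OF Mc] by simp
  qed
  then have asR: "as = map complex_of_real (map Re as)"
    by (simp add: map_idI complex_eq_iff)
  interpret of_real_poly: map_poly_inj_comm_ring_hom complex_of_real ..
  have prod_hom: "map_poly complex_of_real (\<Prod>b\<leftarrow>bs. [:- b, 1:]) =
      (\<Prod>a\<leftarrow>map complex_of_real bs. [:- a, 1:])" for bs
    by (induct bs)
      (auto simp: of_real_poly.hom_mult map_poly_pCons simp del: mult_pCons_left)
  have "map_poly complex_of_real (char_poly M) = char_poly ?M"
    by (rule of_real_hom.char_poly_hom[OF M(1), symmetric])
  also have "\<dots> = map_poly complex_of_real (\<Prod>b\<leftarrow>map Re as. [:- b, 1:])"
    unfolding as(1) by (subst asR, rule prod_hom[symmetric])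
  finally have "char_poly M = (\<Prod>b\<leftarrow>map Re as. [:- b, 1:])"
    by (rule of_real_poly.injectivity)
  moreover have "proots (\<Prod>b\<leftarrow>bs. [:- b, 1:]) = mset bs" for bs :: "real list"
  proof (induct bs)
    case (Cons b bs)
    have "(\<Prod>b\<leftarrow>bs. [:- b, 1:]) \<noteq> 0" by (auto simp: prod_list_zero_iff)
    then have "proots ([:- b, 1:] * (\<Prod>b\<leftarrow>bs. [:- b, 1:])) = {#b#} + mset bs"
      by (subst proots_mult) (auto simp: Cons)
    then show ?case by simp
  qed simp
  ultimately have "proots (char_poly M) = mset (map Re as)"
    by (simp only:)
  then show ?thesis
    using p as(2) by (simp add: gen_eigenvalues_def flip: size_mset)
qed

lemma gen_spectrum_eq_gen_eigenvalues:
  assumes "X \<in> carrier_mat n n" "sym_pos_def n Y"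
  shows "gen_spectrum X Y = set (gen_eigenvalues X Y)"
proof -
  have Y: "Y \<in> carrier_mat n n" using assms by (simp add: sym_pos_def_def)
  obtain M where M: "M \<in> carrier_mat n n"
    and p: "gen_char_poly X Y = Polynomial.smult (det (- Y)) (char_poly M)" "det (- Y) \<noteq> 0"
    using gen_char_poly_nonzero[OF assms] by blast
  have "char_poly M \<noteq> 0" using degree_monic_char_poly[OF M] by auto
  with p have "gen_char_poly X Y \<noteq> 0" by simp
  then show ?thesis
    using poly_gen_char_poly[OF assms(1) Y]
    by (auto simp: gen_spectrum_def gen_eigenvalues_def)
qed

end

theory Submission
  imports Defs "Jordan_Normal_Form.Schur_Decomposition"
begin

text \<open>Write \<open>X \<preceq> Y\<close> for the Loewner order on symmetric matrices. Everything follows from comparing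
  \<open>B\<close> and the matrices \<open>P i j\<close> in this order.

  For symmetric \<open>E\<close> the matrix \<open>lump E - E\<close> is positive semidefinite, by
  \<open>2 |e v\<^sub>k v\<^sub>l| \<le> |e| (v\<^sub>k\<^sup>2 + v\<^sub>l\<^sup>2)\<close>. If \<open>s \<le> i\<close>, the preconditioners with parameters
  \<open>s\<close> and \<open>i\<close> differ exactly by \<open>lump E - E\<close>, where \<open>E\<close> consists of the diagonals of index
  \<open>s, ..., i - 1\<close>; so preconditioners decrease in the parameter (\<open>preconditioner_antimono\<close>), down to the
  matrix itself for the parameter \<open>n\<close>. Kronecker products of positive semidefinite matrices are
  positive semidefinite, hence the Kronecker product is monotone on positive semidefinite matrices
  (\<open>loewner_le_kronecker\<close>), and \<open>B \<preceq> P i j \<preceq> P s q\<close> whenever \<open>s \<le> i\<close> and \<open>q \<le> j\<close>.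

  From \<open>0 < v\<^sup>T B v \<le> v\<^sup>T P v\<close> for \<open>v \<noteq> 0\<close>, every root of \<open>det (B - x P)\<close> lies in \<open>(0, 1]\<close>. Generalized
  eigenvalues decrease when the second matrix grows, by the Courant-Fischer principle
  (\<open>gen_eigenvalue_antimono\<close>): it is derived from a simultaneous diagonalization of the pencil, which
  in turn combines the Schur triangularization of the matrix \<open>M\<close> with \<open>Y M = X\<close> with a triangular
  Cholesky factorization (\<open>simultaneous_diagonalization\<close>). Finally, lumping preserves the row sums of
  a nonnegative matrix, so the vector of ones is a generalized eigenvector with eigenvalue 1, the
  largest possible value.\<close>


section \<open>Quadratic forms and the Loewner order\<close>

lemma quad_form_eq_sum:
  fixes A :: "real mat"
  assumes "A \<in> carrier_mat n n" "v \<in> carrier_vec n"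
  shows "v \<bullet> (A *\<^sub>v v) = (\<Sum>i<n. \<Sum>j<n. A $$ (i, j) * (v $ i * v $ j))"
proof -
  have "v \<bullet> (A *\<^sub>v v) = (\<Sum>i<n. v $ i * (\<Sum>j<n. A $$ (i, j) * v $ j))"
    using assms by (auto simp: scalar_prod_def lessThan_atLeast0 intro!: sum.cong)
  then show ?thesis by (simp add: sum_distrib_left mult.left_commute)
qed

lemma quad_form_add:
  fixes A :: "real mat"
  assumes "A \<in> carrier_mat n n" "B \<in> carrier_mat n n" "v \<in> carrier_vec n"
  shows "v \<bullet> ((A + B) *\<^sub>v v) = v \<bullet> (A *\<^sub>v v) + v \<bullet> (B *\<^sub>v v)"
  using assms add_mult_distrib_mat_vec[OF assms]
    scalar_prod_add_distrib[OF assms(3), of "A *\<^sub>v v" "B *\<^sub>v v"] by simp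

lemma quad_form_smult:
  fixes A :: "real mat"
  assumes "A \<in> carrier_mat n n" "v \<in> carrier_vec n"
  shows "v \<bullet> ((c \<cdot>\<^sub>m A) *\<^sub>v v) = c * (v \<bullet> (A *\<^sub>v v))"
  using assms by (simp add: quad_form_eq_sum[OF _ assms(2)] sum_distrib_left mult.assoc)

text \<open>Symmetry is part of the notion, as in \<^const>\<open>sym_pos_def\<close>.\<close>

definition pos_semidef :: "nat \<Rightarrow> real mat \<Rightarrow> bool" where
  "pos_semidef n A \<longleftrightarrow> A \<in> carrier_mat n n \<and> sym_mat A \<and>
     (\<forall>v \<in> carrier_vec n. 0 \<le> v \<bullet> (A *\<^sub>v v))"

text \<open>The Loewner order \<open>A \<preceq> B\<close>. Only the difference \<open>B - A\<close> is required to be symmetric, not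
  \<open>A\<close> and \<open>B\<close> themselves.\<close>

definition loewner_le :: "nat \<Rightarrow> real mat \<Rightarrow> real mat \<Rightarrow> bool" where
  "loewner_le n A B \<longleftrightarrow> A \<in> carrier_mat n n \<and> B \<in> carrier_mat n n \<and> pos_semidef n (B - A)"

lemma sym_pos_def_imp_pos_semidef: "sym_pos_def n A \<Longrightarrow> pos_semidef n A"
  unfolding sym_pos_def_def pos_semidef_def
  by (metis carrier_matD(1) index_mult_mat_vec less_imp_le mult_mat_vec_carrier order_refl
      scalar_prod_left_zero)

lemma loewner_le_quad_form:
  assumes "loewner_le n A B" "v \<in> carrier_vec n"
  shows "v \<bullet> (A *\<^sub>v v) \<le> v \<bullet> (B *\<^sub>v v)"
proof -
  have c: "A \<in> carrier_mat n n" "B - A \<in> carrier_mat n n" 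
    and p: "0 \<le> v \<bullet> ((B - A) *\<^sub>v v)" and B: "B \<in> carrier_mat n n"
    using assms by (auto simp: loewner_le_def pos_semidef_def)
  have "A + (B - A) = B" using c B by (intro eq_matI) auto
  then show ?thesis using quad_form_add[OF c assms(2)] p by simp
qed

lemma sym_mat_index:
  assumes "A \<in> carrier_mat n n" "sym_mat A" "i < n" "j < n"
  shows "A $$ (i, j) = A $$ (j, i)"
  using assms unfolding sym_mat_def by (metis carrier_matD index_transpose_mat(1))

lemma sym_matI:
  assumes "A \<in> carrier_mat n n" "\<And>i j. i < n \<Longrightarrow> j < n \<Longrightarrow> A $$ (i, j) = A $$ (j, i)"
  shows "sym_mat A"
  unfolding sym_mat_def by (rule eq_matI) (use assms in auto)

lemma sym_pos_def_mono:
  assumes A: "sym_pos_def n A" and AB: "loewner_le n A B"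
  shows "sym_pos_def n B"
proof -
  have c: "A \<in> carrier_mat n n" "B \<in> carrier_mat n n" "sym_mat A" "sym_mat (B - A)"
    using assms by (auto simp: loewner_le_def pos_semidef_def sym_pos_def_def)
  have "sym_mat B"
  proof (rule sym_matI[OF c(2)])
    fix i j assume ij: "i < n" "j < n"
    with sym_mat_index[OF c(1,3) ij] sym_mat_index[OF minus_carrier_mat[OF c(1)] c(4) ij] c(1,2)
    show "B $$ (i, j) = B $$ (j, i)" by simp
  qed
  then show ?thesis
    using A c loewner_le_quad_form[OF AB] unfolding sym_pos_def_def
    by (metis order_less_le_trans)
qed

lemma loewner_le_trans:
  assumes "loewner_le n A B" "loewner_le n B C"
  shows "loewner_le n A C"
proof -
  have c: "A \<in> carrier_mat n n" "B \<in> carrier_mat n n" "C \<in> carrier_mat n n"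
    and s: "sym_mat (B - A)" "sym_mat (C - B)"
    using assms by (auto simp: loewner_le_def pos_semidef_def)
  have e: "C - A = (B - A) + (C - B)" using c by (intro eq_matI) auto
  have "sym_mat (C - A)"
  proof (rule sym_matI[of _ n])
    fix i j assume ij: "i < n" "j < n"
    show "(C - A) $$ (i, j) = (C - A) $$ (j, i)"
      using sym_mat_index[OF minus_carrier_mat s(1) ij] sym_mat_index[OF minus_carrier_mat s(2) ij] c ij
      by simp
  qed (use c in auto)
  moreover have "0 \<le> v \<bullet> ((C - A) *\<^sub>v v)" if v: "v \<in> carrier_vec n" for v
    unfolding e using quad_form_add[of "B - A" n "C - B" v] c v assms
    by (simp add: loewner_le_def pos_semidef_def)
  ultimately show ?thesis using c minus_carrier_mat[OF c(1)]
    by (simp add: loewner_le_def pos_semidef_def)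
qed


section \<open>Triangular Cholesky factorization\<close>

text \<open>Gaussian elimination of a positive semidefinite kernel whose first \<open>m\<close> rows and columns have
  already been cleared. One step subtracts the outer square of the scaled row \<open>m\<close>; the remainder is
  again positive semidefinite, since its value at \<open>v\<close> is the minimum of the original form over
  \<open>v + t e\<^sub>m\<close>. If the pivot vanishes, so does its whole row, and the division by
  \<open>sqrt 0\<close>, which gives 0, makes the step trivial.\<close>

lemma psd_kernel_triangular_factorization:
  fixes A :: "nat \<Rightarrow> nat \<Rightarrow> real"
  assumes "m \<le> n" and "\<And>i j. A i j = A j i"
    and "\<And>v :: nat \<Rightarrow> real. 0 \<le> (\<Sum>i<n. \<Sum>j<n. A i j * (v i * v j))"
    and "\<And>i j. i < m \<Longrightarrow> j < n \<Longrightarrow> A i j = 0"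
  shows "\<exists>R. (\<forall>r<n. \<forall>i<r. R r i = 0) \<and>
    (\<forall>i<n. \<forall>j<n. A i j = (\<Sum>r=m..<n. R r i * R r j))"
  using assms
proof (induction m arbitrary: A rule: inc_induct)
  case base
  then show ?case by (intro exI[of _ "\<lambda>_ _. 0"]) auto
next
  case (step m)
  define c where "c = A m m"
  define a where "a = (\<lambda>j. A m j / sqrt c)"
  have mn: "m < n" by fact
  \<comment> \<open>The form at \<open>v + t e\<^sub>m\<close>, as a polynomial in \<open>t\<close>.\<close>
  have shift: "0 \<le> (\<Sum>i<n. \<Sum>j<n. A i j * (v i * v j)) + 2 * t * (\<Sum>j<n. A m j * v j) + t\<^sup>2 * c"
    for v t
  proof -
    let ?w = "\<lambda>i. v i + t * (if i = m then 1 else 0)"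
    have "0 \<le> (\<Sum>i<n. \<Sum>j<n. A i j * (?w i * ?w j))" by (rule step.prems)
    also have "\<dots> = (\<Sum>i<n. \<Sum>j<n. A i j * (v i * v j)
        + (if j = m then t * (A i m * v i) else 0) + (if i = m then t * (A m j * v j) else 0)
        + (if i = m then if j = m then t\<^sup>2 * c else 0 else 0))"
      by (intro sum.cong) (auto simp: algebra_simps c_def power2_eq_square)
    also have "\<dots> = (\<Sum>i<n. \<Sum>j<n. A i j * (v i * v j)) + (\<Sum>i<n. t * (A i m * v i))
       + (\<Sum>j<n. t * (A m j * v j)) + t\<^sup>2 * c"
    proof -
      have "(\<Sum>i<n. \<Sum>j<n. if i = m then t * (A m j * v j) else 0) = (\<Sum>j<n. t * (A m j * v j))"
        by (subst sum.swap) (use mn in simp)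
      moreover have "(\<Sum>i<n. \<Sum>j<n. if i = m then if j = m then t\<^sup>2 * c else 0 else 0) = t\<^sup>2 * c"
        by (subst sum.swap) (use mn in simp)
      ultimately show ?thesis using mn by (simp add: sum.distrib)
    qed
    also have "(\<Sum>i<n. t * (A i m * v i)) = (\<Sum>j<n. t * (A m j * v j))"
      using step.prems(1)[of m] by simp
    finally show ?thesis by (simp add: mult.assoc flip: sum_distrib_left)
  qed
  have c0: "0 \<le> c" using shift[of "\<lambda>_. 0" 1] by simp
  have degenerate: "A m j = 0" if "c = 0" "j < n" for j
  proof (rule ccontr)
    assume nz: "A m j \<noteq> 0"
    have "(\<Sum>i<n. A m i * (if i = j then 1 else 0)) = A m j"
      using that by (simp add: if_distrib cong: if_cong)
    moreover define K where
      "K = (\<Sum>i<n. \<Sum>k<n. A i k * ((if i = j then 1 else 0) * (if k = j then 1 else 0)))"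
    \<comment> \<open>With \<open>c = 0\<close> the polynomial in \<open>t\<close> is affine with slope \<open>2 A m j\<close>; it takes the value -1
      at this \<open>t\<close>.\<close>
    ultimately show False
      using shift[of "\<lambda>i. if i = j then 1 else 0" "- (K + 1) / (2 * A m j)", folded K_def] nz that
      by (simp add: field_simps)
  qed
  have aa: "a i * a j = A m i * A m j / c" for i j
    using c0 by (simp add: a_def)
  let ?A = "\<lambda>i j. A i j - a i * a j"
  have "\<exists>R. (\<forall>r<n. \<forall>i<r. R r i = 0) \<and>
    (\<forall>i<n. \<forall>j<n. ?A i j = (\<Sum>r=Suc m..<n. R r i * R r j))"
  proof (rule step.IH)
    show "?A i j = ?A j i" for i j using step.prems(1)[of i j] by simp
    show "0 \<le> (\<Sum>i<n. \<Sum>j<n. ?A i j * (v i * v j))" for v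
    proof -
      define b where "b = (\<Sum>j<n. A m j * v j)"
      have "(\<Sum>i<n. \<Sum>j<n. a i * a j * (v i * v j)) = (\<Sum>i<n. \<Sum>j<n. (A m i * v i) * (A m j * v j) / c)"
        by (simp add: aa algebra_simps)
      also have "\<dots> = b * b / c"
        by (simp add: b_def sum_product sum_divide_distrib)
      finally have e: "(\<Sum>i<n. \<Sum>j<n. ?A i j * (v i * v j)) =
          (\<Sum>i<n. \<Sum>j<n. A i j * (v i * v j)) - b * b / c"
        by (simp add: left_diff_distrib sum_subtractf)
      \<comment> \<open>\<open>t = - b / c\<close> minimizes the polynomial.\<close>
      show ?thesis
        using shift[of v "- b / c", folded b_def] unfolding e
        by (cases "c = 0") (auto simp: power2_eq_square)
    qed
    show "?A i j = 0" if "i < Suc m" "j < n" for i j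
    proof (cases "i = m")
      case True
      then show ?thesis using degenerate[OF _ that(2)] by (cases "c = 0") (auto simp: aa c_def)
    next
      case False
      then have "A i j = 0" "A m i = 0"
        using that step.prems(1)[of m i] step.prems(3)[of i] mn by auto
      then show ?thesis by (simp add: a_def)
    qed
  qed
  then obtain R where R: "\<forall>r<n. \<forall>i<r. R r i = 0"
    "\<forall>i<n. \<forall>j<n. ?A i j = (\<Sum>r=Suc m..<n. R r i * R r j)" by blast
  have "A i j = (\<Sum>r=m..<n. (R(m := a)) r i * (R(m := a)) r j)" if "i < n" "j < n" for i j
  proof -
    have "(\<Sum>r=m..<n. (R(m := a)) r i * (R(m := a)) r j) =
        a i * a j + (\<Sum>r=Suc m..<n. (R(m := a)) r i * (R(m := a)) r j)"
      using mn by (simp add: sum.atLeast_Suc_lessThan)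
    also have "\<dots> = A i j" using R(2) that by (simp add: algebra_simps)
    finally show ?thesis by simp
  qed
  moreover have "\<forall>r<n. \<forall>i<r. (R(m := a)) r i = 0"
    using R(1) step.prems(1)[of m] step.prems(3) mn by (auto simp: a_def)
  ultimately show ?case by (intro exI[of _ "R(m := a)"]) blast
qed

lemma pos_semidef_cholesky:
  assumes "pos_semidef n A"
  obtains R where "R \<in> carrier_mat n n" "upper_triangular R" "A = R\<^sup>T * R"
proof -
  have A: "A \<in> carrier_mat n n" "sym_mat A" using assms by (auto simp: pos_semidef_def)
  let ?A = "\<lambda>i j. if i < n \<and> j < n then A $$ (i, j) else 0"
  have "\<exists>R. (\<forall>r<n. \<forall>i<r. R r i = 0) \<and>
    (\<forall>i<n. \<forall>j<n. ?A i j = (\<Sum>r=0..<n. R r i * R r j))"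
  proof (rule psd_kernel_triangular_factorization)
    show "?A i j = ?A j i" for i j using sym_mat_index[OF A] by auto
    fix v :: "nat \<Rightarrow> real"
    have "0 \<le> vec n v \<bullet> (A *\<^sub>v vec n v)" using assms by (simp add: pos_semidef_def)
    then show "0 \<le> (\<Sum>i<n. \<Sum>j<n. ?A i j * (v i * v j))"
      by (simp add: quad_form_eq_sum[OF A(1)])
  qed auto
  then obtain R where R: "\<forall>r<n. \<forall>i<r. R r i = 0"
    "\<forall>i<n. \<forall>j<n. ?A i j = (\<Sum>r=0..<n. R r i * R r j)" by blast
  let ?R = "mat n n (\<lambda>(r, i). R r i)"
  have "A = ?R\<^sup>T * ?R"
    by (rule eq_matI) (use A R in \<open>auto simp: scalar_prod_def\<close>)
  moreover have "upper_triangular ?R" using R by (auto simp: upper_triangular_def)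
  ultimately show ?thesis using that[of ?R] by simp
qed


section \<open>Kronecker products of positive matrices\<close>

lemma kronecker_mat_carrier:
  assumes "A \<in> carrier_mat n n" "B \<in> carrier_mat m m"
  shows "kronecker_mat A B \<in> carrier_mat (n * m) (n * m)"
  using assms by (simp add: kronecker_mat_def)

lemma div_mod_less:
  assumes "k < n * (m :: nat)"
  shows "k div m < n" "k mod m < m"
proof -
  have "0 < m" using assms by (cases m) auto
  then show "k div m < n" "k mod m < m" using assms by (simp_all add: less_mult_imp_div_less)
qed

lemma kronecker_mat_index:
  assumes "A \<in> carrier_mat n n" "B \<in> carrier_mat m m" "i < n * m" "j < n * m"
  shows "kronecker_mat A B $$ (i, j) = A $$ (i div m, j div m) * B $$ (i mod m, j mod m)"
  using assms by (simp add: kronecker_mat_def)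

lemma sum_blocks: "(\<Sum>k<n * m. f k) = (\<Sum>i<n. \<Sum>j<m. f (i * m + j))"
  for f :: "nat \<Rightarrow> 'a :: comm_monoid_add"
proof -
  have "sum f {i * m..<i * m + m} = (\<Sum>j<m. f (i * m + j))" for i
    using sum.shift_bounds_nat_ivl[of f 0 "i * m" m] by (simp add: lessThan_atLeast0 add.commute)
  then show ?thesis using sum.nat_group[of f m n] by simp
qed

lemma sum_swap3: "(\<Sum>j\<in>A. \<Sum>l\<in>B. \<Sum>i\<in>C. f j l i) = (\<Sum>i\<in>C. \<Sum>j\<in>A. \<Sum>l\<in>B. f j l i)"
  for f :: "_ \<Rightarrow> _ \<Rightarrow> _ \<Rightarrow> 'a :: comm_monoid_add"
proof -
  have "(\<Sum>l\<in>B. \<Sum>i\<in>C. f j l i) = (\<Sum>i\<in>C. \<Sum>l\<in>B. f j l i)" for j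
    by (rule sum.swap)
  then show ?thesis by (simp add: sum.swap[of _ C A])
qed

lemma block_index_less: "i < n \<Longrightarrow> j < m \<Longrightarrow> i * m + j < n * (m :: nat)"
  using mult_le_mono1[of "Suc i" n m] by simp

text \<open>Splitting \<open>v\<close> into \<open>n\<close> blocks of length \<open>m\<close>, the form of \<open>R\<^sup>T R \<otimes> B\<close> at \<open>v\<close> is the sum of
  the values of the form of \<open>B\<close> at the blocks of \<open>(R \<otimes> I) v\<close>.\<close>

lemma kronecker_gram_quad_form:
  assumes R: "R \<in> carrier_mat n n" and B: "B \<in> carrier_mat m m" and v: "v \<in> carrier_vec (n * m)"
  shows "v \<bullet> (kronecker_mat (R\<^sup>T * R) B *\<^sub>v v) =
    (\<Sum>r<n. let w = vec m (\<lambda>j. \<Sum>i<n. R $$ (r, i) * v $ (i * m + j)) in w \<bullet> (B *\<^sub>v w))"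
proof -
  define G where "G = (\<lambda>i k. \<Sum>j<m. \<Sum>l<m. B $$ (j, l) * (v $ (i * m + j) * v $ (k * m + l)))"
  have RR: "R\<^sup>T * R \<in> carrier_mat n n" using R by simp
  have RRi: "(R\<^sup>T * R) $$ (i, k) = (\<Sum>r<n. R $$ (r, i) * R $$ (r, k))" if "i < n" "k < n" for i k
    using R that by (auto simp: scalar_prod_def lessThan_atLeast0 intro!: sum.cong)
  have "v \<bullet> (kronecker_mat (R\<^sup>T * R) B *\<^sub>v v) =
    (\<Sum>i<n. \<Sum>j<m. \<Sum>k<n. \<Sum>l<m. (R\<^sup>T * R) $$ (i, k) * B $$ (j, l) *
      (v $ (i * m + j) * v $ (k * m + l)))"
    unfolding quad_form_eq_sum[OF kronecker_mat_carrier[OF RR B] v] sum_blocks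
    by (intro sum.cong refl)
       (simp add: kronecker_mat_index[OF RR B] block_index_less)
  also have "\<dots> = (\<Sum>i<n. \<Sum>k<n. \<Sum>j<m. \<Sum>l<m. (R\<^sup>T * R) $$ (i, k) * B $$ (j, l) *
      (v $ (i * m + j) * v $ (k * m + l)))"
    by (intro sum.cong refl sum.swap)
  also have "\<dots> = (\<Sum>i<n. \<Sum>k<n. (R\<^sup>T * R) $$ (i, k) * G i k)"
    by (simp add: G_def sum_distrib_left mult.assoc)
  also have "\<dots> = (\<Sum>i<n. \<Sum>k<n. \<Sum>r<n. R $$ (r, i) * R $$ (r, k) * G i k)"
    by (intro sum.cong refl) (simp add: RRi sum_distrib_right)
  also have "\<dots> = (\<Sum>r<n. \<Sum>i<n. \<Sum>k<n. R $$ (r, i) * R $$ (r, k) * G i k)"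
    by (rule sum_swap3)
  also have "\<dots> = (\<Sum>r<n. let w = vec m (\<lambda>j. \<Sum>i<n. R $$ (r, i) * v $ (i * m + j)) in w \<bullet> (B *\<^sub>v w))"
  proof (intro sum.cong refl)
    fix r
    define w where "w = vec m (\<lambda>j. \<Sum>i<n. R $$ (r, i) * v $ (i * m + j))"
    have "w \<bullet> (B *\<^sub>v w) = (\<Sum>j<m. \<Sum>l<m. B $$ (j, l) *
        ((\<Sum>i<n. R $$ (r, i) * v $ (i * m + j)) * (\<Sum>k<n. R $$ (r, k) * v $ (k * m + l))))"
      by (subst quad_form_eq_sum[OF B]) (auto simp: w_def intro!: sum.cong)
    also have "\<dots> = (\<Sum>j<m. \<Sum>l<m. \<Sum>i<n. \<Sum>k<n. R $$ (r, i) * R $$ (r, k) *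
        (B $$ (j, l) * (v $ (i * m + j) * v $ (k * m + l))))"
      unfolding sum_product unfolding sum_distrib_left
      by (intro sum.cong refl) (simp add: mult_ac)
    also have "\<dots> = (\<Sum>i<n. \<Sum>j<m. \<Sum>l<m. \<Sum>k<n. R $$ (r, i) * R $$ (r, k) *
        (B $$ (j, l) * (v $ (i * m + j) * v $ (k * m + l))))"
      by (rule sum_swap3)
    also have "\<dots> = (\<Sum>i<n. \<Sum>k<n. \<Sum>j<m. \<Sum>l<m. R $$ (r, i) * R $$ (r, k) *
        (B $$ (j, l) * (v $ (i * m + j) * v $ (k * m + l))))"
      by (intro sum.cong refl sum_swap3)
    also have "\<dots> = (\<Sum>i<n. \<Sum>k<n. R $$ (r, i) * R $$ (r, k) * G i k)"
      by (simp add: G_def sum_distrib_left)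
    finally show "(\<Sum>i<n. \<Sum>k<n. R $$ (r, i) * R $$ (r, k) * G i k) =
      (let w = vec m (\<lambda>j. \<Sum>i<n. R $$ (r, i) * v $ (i * m + j)) in w \<bullet> (B *\<^sub>v w))"
      by (simp add: w_def)
  qed
  finally show ?thesis .
qed

lemma sym_mat_kronecker:
  assumes "A \<in> carrier_mat n n" "B \<in> carrier_mat m m" "sym_mat A" "sym_mat B"
  shows "sym_mat (kronecker_mat A B)"
proof (rule sym_matI[OF kronecker_mat_carrier[OF assms(1,2)]])
  fix i j assume "i < n * m" "j < n * m"
  then show "kronecker_mat A B $$ (i, j) = kronecker_mat A B $$ (j, i)"
    using sym_mat_index[OF assms(1,3), of "i div m" "j div m"]
      sym_mat_index[OF assms(2,4), of "i mod m" "j mod m"]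
    by (simp add: kronecker_mat_index[OF assms(1,2)] div_mod_less)
qed

lemma pos_semidef_kronecker:
  assumes A: "pos_semidef n A" and B: "pos_semidef m B"
  shows "pos_semidef (n * m) (kronecker_mat A B)"
proof -
  obtain R where R: "R \<in> carrier_mat n n" "A = R\<^sup>T * R"
    using pos_semidef_cholesky[OF A] by blast
  have c: "A \<in> carrier_mat n n" "B \<in> carrier_mat m m" "sym_mat A" "sym_mat B"
    using A B by (auto simp: pos_semidef_def)
  have "0 \<le> v \<bullet> (kronecker_mat A B *\<^sub>v v)" if "v \<in> carrier_vec (n * m)" for v
    unfolding R(2) kronecker_gram_quad_form[OF R(1) c(2) that]
    using B by (auto simp: pos_semidef_def Let_def intro!: sum_nonneg)
  then show ?thesis
    using kronecker_mat_carrier[OF c(1,2)] sym_mat_kronecker[OF c] by (simp add: pos_semidef_def)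
qed

text \<open>If the form vanishes at \<open>v\<close>, then all blocks of \<open>(R \<otimes> I) v\<close> vanish because \<open>B\<close> is definite, and
  then so does \<open>v\<close> because \<open>R\<close> is invertible.\<close>

lemma sym_pos_def_kronecker:
  assumes A: "sym_pos_def n A" and B: "sym_pos_def m B"
  shows "sym_pos_def (n * m) (kronecker_mat A B)"
proof -
  have A': "pos_semidef n A" and B': "pos_semidef m B"
    using A B by (auto intro: sym_pos_def_imp_pos_semidef)
  obtain R where R: "R \<in> carrier_mat n n" "A = R\<^sup>T * R"
    using pos_semidef_cholesky[OF A'] by blast
  have c: "A \<in> carrier_mat n n" "B \<in> carrier_mat m m"
    using A B by (auto simp: sym_pos_def_def)
  have RT: "R\<^sup>T \<in> carrier_mat n n" using R by simp
  have "det R \<noteq> 0"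
    using sym_pos_def_det_nonzero[OF A] det_mult[OF RT R(1)] R by auto
  have "v = 0\<^sub>v (n * m)"
    if v: "v \<in> carrier_vec (n * m)" and 0: "v \<bullet> (kronecker_mat A B *\<^sub>v v) = 0" for v
  proof -
    define w where "w = (\<lambda>r. vec m (\<lambda>j. \<Sum>i<n. R $$ (r, i) * v $ (i * m + j)))"
    have w: "w r \<in> carrier_vec m" for r by (simp add: w_def)
    have "(\<Sum>r<n. w r \<bullet> (B *\<^sub>v w r)) = 0"
      using 0 unfolding R(2) kronecker_gram_quad_form[OF R(1) c(2) v] by (simp add: w_def Let_def)
    then have "w r \<bullet> (B *\<^sub>v w r) = 0" if "r < n" for r
      using B' w that by (subst (asm) sum_nonneg_eq_0_iff) (auto simp: pos_semidef_def)
    then have w0: "w r = 0\<^sub>v m" if "r < n" for r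
      using B w that unfolding sym_pos_def_def by (metis less_irrefl)
    have col0: "vec n (\<lambda>i. v $ (i * m + j)) = 0\<^sub>v n" if j: "j < m" for j
    proof (rule ccontr)
      assume "vec n (\<lambda>i. v $ (i * m + j)) \<noteq> 0\<^sub>v n"
      moreover have "R *\<^sub>v vec n (\<lambda>i. v $ (i * m + j)) = 0\<^sub>v n"
      proof (rule eq_vecI)
        fix r assume r: "r < dim_vec (0\<^sub>v n :: real vec)"
        then have "(\<Sum>i<n. R $$ (r, i) * v $ (i * m + j)) = 0"
          using arg_cong[OF w0, of r "\<lambda>w. w $ j"] j by (simp add: w_def)
        then show "(R *\<^sub>v vec n (\<lambda>i. v $ (i * m + j))) $ r = 0\<^sub>v n $ r"
          using r R(1) by (simp add: scalar_prod_def lessThan_atLeast0)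
      qed (use R in simp)
      ultimately show False
        using \<open>det R \<noteq> 0\<close> det_0_iff_vec_prod_zero_field[OF R(1)] vec_carrier by blast
    qed
    show ?thesis
    proof (rule eq_vecI)
      fix k assume k: "k < dim_vec (0\<^sub>v (n * m) :: real vec)"
      then have "k div m < n" "k mod m < m" using div_mod_less[of k n m] by auto
      then show "v $ k = 0\<^sub>v (n * m) $ k"
        using arg_cong[OF col0[of "k mod m"], of "\<lambda>w. w $ (k div m)"] k by simp
    qed (use v in simp)
  qed
  then show ?thesis
    using pos_semidef_kronecker[OF A' B'] unfolding sym_pos_def_def pos_semidef_def
    by (metis order_le_less)
qed

text \<open>Monotonicity in each argument separately, through \<open>A \<otimes> B'\<close>.\<close>

lemma loewner_le_kronecker:
  assumes A: "loewner_le n A A'" and B: "loewner_le m B B'"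
    and A'0: "pos_semidef n A" and B0: "pos_semidef m B'"
  shows "loewner_le (n * m) (kronecker_mat A B) (kronecker_mat A' B')"
proof (rule loewner_le_trans)
  have c: "A \<in> carrier_mat n n" "A' \<in> carrier_mat n n" "A' - A \<in> carrier_mat n n"
    "B \<in> carrier_mat m m" "B' \<in> carrier_mat m m" "B' - B \<in> carrier_mat m m"
    using A B by (auto simp: loewner_le_def pos_semidef_def)
  have "kronecker_mat A B' - kronecker_mat A B = kronecker_mat A (B' - B)"
    using c by (intro eq_matI) (auto simp: kronecker_mat_def div_mod_less algebra_simps)
  then show "loewner_le (n * m) (kronecker_mat A B) (kronecker_mat A B')"
    using c B pos_semidef_kronecker[OF A'0, of m "B' - B"]
    by (simp add: loewner_le_def kronecker_mat_carrier)
  have "kronecker_mat A' B' - kronecker_mat A B' = kronecker_mat (A' - A) B'"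
    using c by (intro eq_matI) (auto simp: kronecker_mat_def div_mod_less algebra_simps)
  then show "loewner_le (n * m) (kronecker_mat A B') (kronecker_mat A' B')"
    using c A pos_semidef_kronecker[OF _ B0, of n "A' - A"]
    by (simp add: loewner_le_def kronecker_mat_carrier)
qed


section \<open>Lumping and preconditioners\<close>

lemma pos_semidef_lump_minus:
  assumes E: "E \<in> carrier_mat n n" "sym_mat E"
  shows "pos_semidef n (lump E - E)"
proof -
  have L: "lump E \<in> carrier_mat n n" unfolding lump_def using E(1) by simp
  have LE: "lump E - E \<in> carrier_mat n n" using E(1) by (rule minus_carrier_mat)
  have Li: "lump E $$ (i, j) = (if i = j then \<Sum>k<n. \<bar>E $$ (i, k)\<bar> else 0)" if "i < n" "j < n" for i j
    using E(1) that by (cases "i = j") (auto simp: lump_def mat_diag_def)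
  have "sym_mat (lump E - E)"
  proof (rule sym_matI[OF LE])
    fix i j assume ij: "i < n" "j < n"
    have "lump E $$ (i, j) = lump E $$ (j, i)" using ij by (cases "i = j") (simp_all add: Li)
    then show "(lump E - E) $$ (i, j) = (lump E - E) $$ (j, i)"
      using sym_mat_index[OF E ij] E L ij by simp
  qed
  moreover have "0 \<le> v \<bullet> ((lump E - E) *\<^sub>v v)" if v: "v \<in> carrier_vec n" for v
  proof -
    have row: "(\<Sum>i<n. \<Sum>j<n. lump E $$ (i, j) * (v $ i * v $ j)) = (\<Sum>i<n. \<Sum>j<n. \<bar>E $$ (i, j)\<bar> * (v $ i)\<^sup>2)"
    proof (rule sum.cong[OF refl])
      fix i assume "i \<in> {..<n}"
      then have i: "i < n" by simp
      have "(\<Sum>j<n. lump E $$ (i, j) * (v $ i * v $ j)) =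
          (\<Sum>j<n. if j = i then (\<Sum>k<n. \<bar>E $$ (i, k)\<bar>) * (v $ i * v $ j) else 0)"
        by (intro sum.cong refl) (simp add: Li i)
      also have "\<dots> = (\<Sum>j<n. \<bar>E $$ (i, j)\<bar> * (v $ i)\<^sup>2)"
        using i by (simp add: power2_eq_square sum_distrib_right)
      finally show "(\<Sum>j<n. lump E $$ (i, j) * (v $ i * v $ j)) = (\<Sum>j<n. \<bar>E $$ (i, j)\<bar> * (v $ i)\<^sup>2)" .
    qed
    have col: "(\<Sum>i<n. \<Sum>j<n. \<bar>E $$ (i, j)\<bar> * (v $ i)\<^sup>2) = (\<Sum>i<n. \<Sum>j<n. \<bar>E $$ (i, j)\<bar> * (v $ j)\<^sup>2)"
      by (subst sum.swap) (intro sum.cong refl, simp add: sym_mat_index[OF E])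
    have form: "v \<bullet> ((lump E - E) *\<^sub>v v) =
        (\<Sum>i<n. \<Sum>j<n. \<bar>E $$ (i, j)\<bar> * (v $ i)\<^sup>2) - (\<Sum>i<n. \<Sum>j<n. E $$ (i, j) * (v $ i * v $ j))"
      unfolding quad_form_eq_sum[OF LE v] row[symmetric] sum_subtractf[symmetric]
      using L E by (intro sum.cong refl) (simp add: left_diff_distrib)
    have pair: "2 * (E $$ (i, j) * (v $ i * v $ j)) \<le>
        \<bar>E $$ (i, j)\<bar> * (v $ i)\<^sup>2 + \<bar>E $$ (i, j)\<bar> * (v $ j)\<^sup>2" for i j
    proof -
      have "2 * (E $$ (i, j) * (v $ i * v $ j)) \<le> 2 * (\<bar>E $$ (i, j)\<bar> * (\<bar>v $ i\<bar> * \<bar>v $ j\<bar>))"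
        by (metis abs_ge_self abs_mult mult_left_mono zero_le_numeral)
      also have "\<dots> = \<bar>E $$ (i, j)\<bar> * (2 * \<bar>v $ i\<bar> * \<bar>v $ j\<bar>)" by simp
      also have "\<dots> \<le> \<bar>E $$ (i, j)\<bar> * (\<bar>v $ i\<bar>\<^sup>2 + \<bar>v $ j\<bar>\<^sup>2)"
        by (intro mult_left_mono sum_squares_bound) simp
      finally show ?thesis by (simp add: distrib_left)
    qed
    have "2 * (\<Sum>i<n. \<Sum>j<n. E $$ (i, j) * (v $ i * v $ j)) \<le>
        (\<Sum>i<n. \<Sum>j<n. \<bar>E $$ (i, j)\<bar> * (v $ i)\<^sup>2 + \<bar>E $$ (i, j)\<bar> * (v $ j)\<^sup>2)"
      unfolding sum_distrib_left by (intro sum_mono pair)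
    also have "\<dots> = 2 * (\<Sum>i<n. \<Sum>j<n. \<bar>E $$ (i, j)\<bar> * (v $ i)\<^sup>2)"
      by (simp only: sum.distrib col[symmetric] mult_2)
    finally show ?thesis unfolding form by simp
  qed
  ultimately show ?thesis using LE by (simp add: pos_semidef_def)
qed

lemma preconditioner_carrier: "C \<in> carrier_mat n n \<Longrightarrow> preconditioner i C \<in> carrier_mat n n"
  by (auto simp: preconditioner_def band_part_def lump_def mat_diag_def)

text \<open>With a larger parameter \<open>i\<close>, more of \<open>C\<close> is kept and less is lumped. The part \<open>E\<close> lumped for
  \<open>s\<close> but kept for \<open>i\<close> has support disjoint from the part lumped for both, so the two contribute
  additively to the absolute row sums.\<close>

lemma preconditioner_antimono:
  assumes C: "C \<in> carrier_mat n n" "sym_mat C" and "s \<le> i"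
  shows "loewner_le n (preconditioner i C) (preconditioner s C)"
proof -
  define E where "E = band_part i C - band_part s C"
  have E: "E \<in> carrier_mat n n"
    unfolding E_def by (rule minus_carrier_mat) (use C in \<open>simp add: band_part_def\<close>)
  have "sym_mat E"
    by (rule sym_matI[OF E]) (use sym_mat_index[OF C] C in \<open>auto simp: E_def band_part_def\<close>)
  moreover have "preconditioner s C - preconditioner i C = lump E - E"
  proof (rule eq_matI)
    fix k l assume "k < dim_row (lump E - E)" "l < dim_col (lump E - E)"
    then have kl: "k < n" "l < n" using E by auto
    have "(\<Sum>j<n. \<bar>(C - band_part s C) $$ (k, j)\<bar>) =
      (\<Sum>j<n. \<bar>(C - band_part i C) $$ (k, j)\<bar>) + (\<Sum>j<n. \<bar>E $$ (k, j)\<bar>)"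
      unfolding sum.distrib[symmetric]
      using C kl \<open>s \<le> i\<close> by (intro sum.cong refl) (auto simp: E_def band_part_def)
    then show "(preconditioner s C - preconditioner i C) $$ (k, l) = (lump E - E) $$ (k, l)"
      using C kl E unfolding preconditioner_def lump_def
      by (auto simp: mat_diag_def E_def band_part_def)
  qed (use C E in \<open>auto simp: preconditioner_def lump_def mat_diag_def band_part_def\<close>)
  ultimately show ?thesis
    using pos_semidef_lump_minus[OF E] preconditioner_carrier[OF C(1)]
    by (simp add: loewner_le_def)
qed

lemma preconditioner_full:
  assumes "C \<in> carrier_mat n n"
  shows "preconditioner n C = C"
proof -
  have "band_part n C = C"
    using assms by (intro eq_matI) (auto simp: band_part_def)
  then show ?thesis
    using assms by (intro eq_matI) (auto simp: preconditioner_def lump_def mat_diag_def)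
qed

text \<open>For a nonnegative matrix, lumping moves the entries of a row outside the band to the diagonal.\<close>

lemma preconditioner_row_sum:
  assumes C: "C \<in> carrier_mat n n" "nonneg_mat C" and k: "k < n"
  shows "(\<Sum>l<n. preconditioner i C $$ (k, l)) = (\<Sum>l<n. C $$ (k, l))"
proof -
  have nn: "0 \<le> C $$ (k, l)" if "l < n" for l
    using C k that by (auto simp: nonneg_mat_def elements_mat_def)
  have "preconditioner i C $$ (k, l) = band_part i C $$ (k, l) +
      (if l = k then \<Sum>j<n. (C - band_part i C) $$ (k, j) else 0)" if "l < n" for l
    using C k nn that by (auto simp: preconditioner_def band_part_def lump_def mat_diag_def intro!: sum.cong)
  then have "(\<Sum>l<n. preconditioner i C $$ (k, l)) =
      (\<Sum>l<n. band_part i C $$ (k, l)) + (\<Sum>j<n. (C - band_part i C) $$ (k, j))"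
    using k by (simp add: sum.distrib)
  also have "\<dots> = (\<Sum>l<n. C $$ (k, l))"
    unfolding sum.distrib[symmetric] using C k by (intro sum.cong) (auto simp: band_part_def)
  finally show ?thesis .
qed


section \<open>Simultaneous diagonalization of a pencil\<close>

lemma poly_eq_prod_list_proots:
  fixes p :: "'a :: field poly"
  assumes "mset es = proots p" "length es = degree p" "monic p"
  shows "p = (\<Prod>e\<leftarrow>es. [:- e, 1:])"
  using assms
proof (induction es arbitrary: p)
  case Nil
  then show ?case using monic_degree_0[of p] by simp
next
  case (Cons e es)
  have p0: "p \<noteq> 0" using Cons.prems by auto
  have "e \<in># proots p" by (simp flip: Cons.prems(1))
  then have "poly p e = 0" using p0 by simp
  then obtain q where q: "p = [:- e, 1:] * q" using poly_eq_0_iff_dvd by (metis dvdE)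
  have q0: "q \<noteq> 0" using p0 q by auto
  have "monic q" using Cons.prems(3) q0 unfolding q by (simp only: lead_coeff_mult) simp
  moreover have "length es = degree q"
    using Cons.prems(2) q0 unfolding q by (subst (asm) degree_mult_eq) auto
  moreover have "mset es = proots q"
    using Cons.prems(1) q0 unfolding q by (subst (asm) proots_mult) auto
  ultimately show ?case using Cons.IH[of q] q by simp
qed

lemma upper_triangular_mult_index:
  fixes R :: "'a :: semiring_0 mat"
  assumes "R \<in> carrier_mat n n" "B \<in> carrier_mat n n" "upper_triangular R" "upper_triangular B"
    and "i < n" "j \<le> i"
  shows "(R * B) $$ (i, j) = (if i = j then R $$ (i, i) * B $$ (i, i) else 0)"
proof -
  have "R $$ (i, k) * B $$ (k, j) = (if k = i \<and> i = j then R $$ (i, i) * B $$ (i, i) else 0)"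
    if "k < n" for k
    using assms that upper_triangularD[OF assms(3), of k i] upper_triangularD[OF assms(4), of j k]
    by (cases k i rule: linorder_cases) auto
  then have "(R * B) $$ (i, j) =
      (\<Sum>k<n. if k = i \<and> i = j then R $$ (i, i) * B $$ (i, i) else 0)"
    using assms by (auto simp: scalar_prod_def lessThan_atLeast0 intro!: sum.cong)
  then show ?thesis using assms(5) by (cases "i = j") auto
qed

text \<open>Let \<open>S\<close> be the inverse of \<open>R\<close>. The symmetry hypothesis says that \<open>R B S\<close>, which is
  upper triangular with the diagonal of \<open>B\<close>, is symmetric; hence it is the diagonal matrix \<open>D\<close> with that diagonal, i.e.
  \<open>R B = D R\<close>. The proof below compares the entries of the symmetric matrix row by row and needs no
  inverse.\<close>

lemma upper_triangular_sym_gram_diagonal: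
  fixes R :: "'a :: field mat"
  assumes R: "R \<in> carrier_mat n n" "upper_triangular R" "\<And>i. i < n \<Longrightarrow> R $$ (i, i) \<noteq> 0"
    and B: "B \<in> carrier_mat n n" "upper_triangular B"
    and sym: "\<And>i j. i < n \<Longrightarrow> j < n \<Longrightarrow> (R\<^sup>T * (R * B)) $$ (i, j) = (R\<^sup>T * (R * B)) $$ (j, i)"
    and i: "i < n"
  shows "\<forall>j<n. (R * B) $$ (i, j) = B $$ (i, i) * R $$ (i, j)"
  using i
proof (induction i rule: less_induct)
  case (less i)
  define C where "C = R * B"
  have C: "C \<in> carrier_mat n n" using R B by (simp add: C_def)
  have Cl: "C $$ (k, j) = 0" if "k < n" "j < k" for j k
    using upper_triangular_mult_index[OF R(1) B(1) R(2) B(2), of k j] that by (simp add: C_def)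
  have Rl: "R $$ (k, j) = 0" if "k < n" "j < k" for j k
    using upper_triangularD[OF R(2), of j k] R(1) that by simp
  have Cii: "C $$ (i, i) = R $$ (i, i) * B $$ (i, i)"
    using upper_triangular_mult_index[OF R(1) B(1) R(2) B(2), of i i] less.prems
    by (simp add: C_def)
  have gram: "(R\<^sup>T * C) $$ (i, j) = (\<Sum>k<n. R $$ (k, i) * C $$ (k, j))" if "i < n" "j < n" for i j
    using R(1) C that by (auto simp: scalar_prod_def lessThan_atLeast0 intro!: sum.cong)
  have "C $$ (i, j) = B $$ (i, i) * R $$ (i, j)" if j: "j < n" for j
  proof (cases "j < i")
    case True
    then show ?thesis using Cl Rl less.prems by simp
  next
    case False
    \<comment> \<open>Rows \<open>k < i\<close> of \<open>R B\<close> are proportional to those of \<open>R\<close> by induction, so their contributions to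
      the entries \<open>(i, j)\<close> and \<open>(j, i)\<close> cancel; for \<open>k > i\<close> column \<open>i\<close> vanishes.\<close>
    have zero: "R $$ (k, i) * C $$ (k, j) - R $$ (k, j) * C $$ (k, i) = 0" if "k < n" "k \<noteq> i" for k
    proof (cases "k < i")
      case True
      then show ?thesis
        using less.IH[OF True that(1)] less.prems j by (simp add: C_def)
    next
      case False
      then show ?thesis using that Cl[of k i] Rl[of k i] by simp
    qed
    have "0 = (\<Sum>k<n. R $$ (k, i) * C $$ (k, j) - R $$ (k, j) * C $$ (k, i))"
      using sym[OF less.prems j] gram[OF less.prems j] gram[OF j less.prems]
      by (simp add: C_def sum_subtractf)
    also have "\<dots> = (\<Sum>k<n. if k = i then R $$ (k, i) * C $$ (k, j) - R $$ (k, j) * C $$ (k, i) else 0)"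
      by (intro sum.cong refl) (use zero in auto)
    also have "\<dots> = R $$ (i, i) * C $$ (i, j) - R $$ (i, j) * C $$ (i, i)"
      using less.prems by simp
    finally have "R $$ (i, i) * C $$ (i, j) = R $$ (i, i) * (B $$ (i, i) * R $$ (i, j))"
      by (simp add: Cii mult_ac)
    then show ?thesis using R(3)[OF less.prems] by (simp only: mult_cancel_left) simp
  qed
  then show ?case by (simp add: C_def)
qed

text \<open>The generalized eigenvalues are the eigenvalues, in ascending order, of the matrix \<open>M\<close> with
  \<open>Y M = X\<close>.\<close>

lemma gen_eigenvalues_char_poly:
  assumes X: "X \<in> carrier_mat n n" "sym_mat X" and Y: "sym_pos_def n Y"
  obtains M where "M \<in> carrier_mat n n" "Y * M = X"
    "char_poly M = (\<Prod>e\<leftarrow>gen_eigenvalues X Y. [:- e, 1:])"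
proof -
  obtain M where M: "M \<in> carrier_mat n n" "Y * M = X"
    and p: "gen_char_poly X Y = Polynomial.smult (det (- Y)) (char_poly M)" "det (- Y) \<noteq> 0"
    using gen_char_poly_nonzero[OF X(1) Y] by blast
  have "char_poly M = (\<Prod>e\<leftarrow>gen_eigenvalues X Y. [:- e, 1:])"
  proof (rule poly_eq_prod_list_proots)
    show "mset (gen_eigenvalues X Y) = proots (char_poly M)"
      using p by (simp add: gen_eigenvalues_def)
    show "length (gen_eigenvalues X Y) = degree (char_poly M)"
      using length_gen_eigenvalues[OF X Y] degree_monic_char_poly[OF M(1)] by simp
    show "monic (char_poly M)" using degree_monic_char_poly[OF M(1)] by simp
  qed
  then show ?thesis using that M by blast
qed

lemma congruence_quad_form:
  fixes P :: "real mat"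
  assumes "P \<in> carrier_mat n n" "A \<in> carrier_mat n n" "v \<in> carrier_vec n"
  shows "v \<bullet> ((P\<^sup>T * A * P) *\<^sub>v v) = (P *\<^sub>v v) \<bullet> (A *\<^sub>v (P *\<^sub>v v))"
proof -
  have "v \<bullet> ((P\<^sup>T * A * P) *\<^sub>v v) = v \<bullet> (P\<^sup>T *\<^sub>v (A *\<^sub>v (P *\<^sub>v v)))"
    using assms by (simp add: assoc_mult_mat_vec[of _ n n _ n])
  also have "\<dots> = (P\<^sup>T *\<^sub>v (A *\<^sub>v (P *\<^sub>v v))) \<bullet> v"
    by (rule comm_scalar_prod[of _ n]) (use assms in auto)
  also have "\<dots> = (A *\<^sub>v (P *\<^sub>v v)) \<bullet> (P *\<^sub>v v)"
    using transpose_vec_mult_scalar[of P n n v "A *\<^sub>v (P *\<^sub>v v)"] assms by simp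
  also have "\<dots> = (P *\<^sub>v v) \<bullet> (A *\<^sub>v (P *\<^sub>v v))"
    by (rule comm_scalar_prod[of _ n]) (use assms in auto)
  finally show ?thesis .
qed

lemma sym_mat_congruence:
  assumes "P \<in> carrier_mat n n" "A \<in> carrier_mat n n" "sym_mat A"
  shows "sym_mat (P\<^sup>T * A * P)"
  using assms unfolding sym_mat_def
  by (simp add: transpose_mult[of _ n n _ n] assoc_mult_mat[of _ n n _ n _ n])

text \<open>In the coordinates \<open>W v\<close> both forms are diagonal: \<open>Y\<close> becomes the identity and \<open>X\<close> the diagonal
  matrix of the ascending generalized eigenvalues. Let \<open>M = P B Q\<close> be a Schur triangularization of
  the matrix \<open>M\<close> with \<open>Y M = X\<close>, where \<open>P\<close> need not be orthogonal, and let \<open>P\<^sup>T Y P = R\<^sup>T R\<close> with \<open>R\<close> upper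
  triangular. Then \<open>R\<^sup>T R B = P\<^sup>T X P\<close> is symmetric, hence \<open>R B = D R\<close> with \<open>D\<close> diagonal, and
  \<open>W = R Q\<close> works.\<close>

lemma simultaneous_diagonalization:
  assumes X: "X \<in> carrier_mat n n" "sym_mat X" and Y: "sym_pos_def n Y"
  obtains W where "W \<in> carrier_mat n n"
    "\<And>v. v \<in> carrier_vec n \<Longrightarrow> v \<bullet> (Y *\<^sub>v v) = (\<Sum>i<n. ((W *\<^sub>v v) $ i)\<^sup>2)"
    "\<And>v. v \<in> carrier_vec n \<Longrightarrow>
       v \<bullet> (X *\<^sub>v v) = (\<Sum>i<n. gen_eigenvalues X Y ! i * ((W *\<^sub>v v) $ i)\<^sup>2)"
proof -
  have Yc: "Y \<in> carrier_mat n n" "sym_mat Y" using Y by (auto simp: sym_pos_def_def)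
  obtain M where M: "M \<in> carrier_mat n n" "Y * M = X"
    and cp: "char_poly M = (\<Prod>e\<leftarrow>gen_eigenvalues X Y. [:- e, 1:])"
    using gen_eigenvalues_char_poly[OF X Y] by blast
  obtain B P Q where BPQ: "schur_decomposition M (gen_eigenvalues X Y) = (B, P, Q)"
    using prod_cases3 by blast
  from schur_decomposition[OF M(1) cp BPQ] have wit: "similar_mat_wit M B P Q"
    and B: "upper_triangular B" and diag: "diag_mat B = gen_eigenvalues X Y" by auto
  from similar_mat_witD2[OF M(1) wit] have c: "B \<in> carrier_mat n n" "P \<in> carrier_mat n n"
    "Q \<in> carrier_mat n n" and PQ: "P * Q = 1\<^sub>m n" "Q * P = 1\<^sub>m n" and MPBQ: "M = P * B * Q" by auto
  have PT: "P\<^sup>T \<in> carrier_mat n n" using c by simp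
  have Bii: "B $$ (i, i) = gen_eigenvalues X Y ! i" if "i < n" for i
    using that c(1) by (simp flip: diag add: diag_mat_def)
  have PQv: "P *\<^sub>v (Q *\<^sub>v v) = v" if "v \<in> carrier_vec n" for v
    using assoc_mult_mat_vec[OF c(2,3) that] that by (simp add: PQ)
  define G where "G = P\<^sup>T * Y * P"
  have G: "G \<in> carrier_mat n n" using c Yc by (simp add: G_def)
  have "pos_semidef n G"
    using G sym_mat_congruence[OF c(2) Yc] congruence_quad_form[OF c(2) Yc(1)] c(2)
      sym_pos_def_imp_pos_semidef[OF Y]
    by (simp add: pos_semidef_def G_def)
  then obtain R where R: "R \<in> carrier_mat n n" "upper_triangular R" and GR: "G = R\<^sup>T * R"
    by (rule pos_semidef_cholesky)
  have RT: "R\<^sup>T \<in> carrier_mat n n" using R by simp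
  have "det P \<noteq> 0" using det_mult[OF c(2,3)] by (auto simp: PQ)
  then have "det G \<noteq> 0"
    using sym_pos_def_det_nonzero[OF Y] c Yc PT unfolding G_def
    by (simp add: det_mult[of _ n] det_transpose)
  then have "det R \<noteq> 0" using det_mult[OF RT R(1)] GR by auto
  then have Rii: "R $$ (i, i) \<noteq> 0" if "i < n" for i
    using det_upper_triangular[OF R(2,1)] that R(1) by (auto simp: diag_mat_def)
  have MP: "M * P = P * B"
    using c by (simp add: MPBQ assoc_mult_mat[of _ n n _ n _ n] PQ)
  have PXP: "P\<^sup>T * X * P = R\<^sup>T * (R * B)"
  proof -
    have "P\<^sup>T * X * P = P\<^sup>T * Y * (M * P)"
      using c M Yc PT by (simp flip: M(2) add: assoc_mult_mat[of _ n n _ n _ n])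
    also have "\<dots> = G * B"
      using c M Yc PT by (simp add: MP G_def assoc_mult_mat[of _ n n _ n _ n])
    also have "\<dots> = R\<^sup>T * (R * B)"
      using R c RT by (simp add: GR assoc_mult_mat[of _ n n _ n _ n])
    finally show ?thesis .
  qed
  have "(R\<^sup>T * (R * B)) $$ (i, j) = (R\<^sup>T * (R * B)) $$ (j, i)" if "i < n" "j < n" for i j
    using sym_mat_index[OF _ sym_mat_congruence[OF c(2) X] that] c R RT unfolding PXP by simp
  from upper_triangular_sym_gram_diagonal[OF R Rii c(1) B this]
  have RB: "(R * B) $$ (i, j) = gen_eigenvalues X Y ! i * R $$ (i, j)" if "i < n" "j < n" for i j
    using that by (simp add: Bii)
  show ?thesis
  proof (rule that[of "R * Q"])
    show "R * Q \<in> carrier_mat n n" using R c by simp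
    fix v :: "real vec" assume v: "v \<in> carrier_vec n"
    define u where "u = Q *\<^sub>v v"
    have u: "u \<in> carrier_vec n" and Pu: "P *\<^sub>v u = v" using c v PQv by (auto simp: u_def)
    have Wv: "(R * Q) *\<^sub>v v = R *\<^sub>v u" using R c v by (simp add: u_def assoc_mult_mat_vec[of _ n n _ n])
    have RBu: "((R * B) *\<^sub>v u) $ i = gen_eigenvalues X Y ! i * (R *\<^sub>v u) $ i" if "i < n" for i
    proof -
      have RBc: "R * B \<in> carrier_mat n n" using R c by simp
      have "((R * B) *\<^sub>v u) $ i = row (R * B) i \<bullet> u"
        using that RBc by (intro index_mult_mat_vec) auto
      also have "\<dots> = (\<Sum>j<n. (R * B) $$ (i, j) * u $ j)"
        unfolding scalar_prod_def lessThan_atLeast0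
        by (rule sum.cong) (use that RBc u in \<open>auto simp del: index_mult_mat\<close>)
      also have "\<dots> = gen_eigenvalues X Y ! i * (\<Sum>j<n. R $$ (i, j) * u $ j)"
        using that by (simp add: RB sum_distrib_left mult.assoc)
      also have "(\<Sum>j<n. R $$ (i, j) * u $ j) = (R *\<^sub>v u) $ i"
        using that R u by (auto simp: scalar_prod_def lessThan_atLeast0 intro!: sum.cong)
      finally show ?thesis .
    qed
    have move: "u \<bullet> ((R\<^sup>T * C) *\<^sub>v u) = (\<Sum>i<n. (R *\<^sub>v u) $ i * (C *\<^sub>v u) $ i)"
      if "C \<in> carrier_mat n n" for C
    proof -
      have "u \<bullet> ((R\<^sup>T * C) *\<^sub>v u) = (R\<^sup>T *\<^sub>v (C *\<^sub>v u)) \<bullet> u"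
        using that R u RT comm_scalar_prod[OF u, of "R\<^sup>T *\<^sub>v (C *\<^sub>v u)"]
        by (simp add: assoc_mult_mat_vec[of _ n n _ n])
      also have "\<dots> = (C *\<^sub>v u) \<bullet> (R *\<^sub>v u)"
        using transpose_vec_mult_scalar[OF R(1) u, of "C *\<^sub>v u"] that u by simp
      finally show ?thesis
        using that R u by (simp add: scalar_prod_def lessThan_atLeast0 mult.commute)
    qed
    have "v \<bullet> (Y *\<^sub>v v) = u \<bullet> (G *\<^sub>v u)"
      using congruence_quad_form[OF c(2) Yc(1) u] by (simp add: Pu G_def)
    then show "v \<bullet> (Y *\<^sub>v v) = (\<Sum>i<n. (((R * Q) *\<^sub>v v) $ i)\<^sup>2)"
      using move[OF R(1)] by (simp add: GR Wv power2_eq_square)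
    have "v \<bullet> (X *\<^sub>v v) = u \<bullet> ((R\<^sup>T * (R * B)) *\<^sub>v u)"
      using congruence_quad_form[OF c(2) X(1) u] by (simp add: Pu PXP)
    also have "\<dots> = (\<Sum>i<n. gen_eigenvalues X Y ! i * ((R *\<^sub>v u) $ i)\<^sup>2)"
      unfolding move[OF mult_carrier_mat[OF R(1) c(1)]]
      by (rule sum.cong[OF refl]) (simp add: RBu power2_eq_square del: index_mult_mat_vec)
    finally show "v \<bullet> (X *\<^sub>v v) = (\<Sum>i<n. gen_eigenvalues X Y ! i * (((R * Q) *\<^sub>v v) $ i)\<^sup>2)"
      by (simp add: Wv)
  qed
qed


section \<open>Bounds and monotonicity of generalized eigenvalues\<close>

lemma gen_spectrum_vector:
  assumes "X \<in> carrier_mat n n" "Y \<in> carrier_mat n n" "x \<in> gen_spectrum X Y"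
  obtains v where "v \<in> carrier_vec n" "v \<noteq> 0\<^sub>v n" "v \<bullet> (X *\<^sub>v v) = x * (v \<bullet> (Y *\<^sub>v v))"
proof -
  have c: "X - x \<cdot>\<^sub>m Y \<in> carrier_mat n n" by (rule minus_carrier_mat) (use assms in simp)
  have "det (X - x \<cdot>\<^sub>m Y) = 0" using assms(3) by (simp add: gen_spectrum_def)
  then obtain v where v: "v \<in> carrier_vec n" "v \<noteq> 0\<^sub>v n" "(X - x \<cdot>\<^sub>m Y) *\<^sub>v v = 0\<^sub>v n"
    using det_0_iff_vec_prod_zero_field[OF c] by blast
  have "X = (X - x \<cdot>\<^sub>m Y) + x \<cdot>\<^sub>m Y" using assms by (intro eq_matI) auto
  then have "v \<bullet> (X *\<^sub>v v) = v \<bullet> ((X - x \<cdot>\<^sub>m Y) *\<^sub>v v) + v \<bullet> ((x \<cdot>\<^sub>m Y) *\<^sub>v v)"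
    using quad_form_add[OF c smult_carrier_mat[OF assms(2)] v(1)] by metis
  then have "v \<bullet> (X *\<^sub>v v) = x * (v \<bullet> (Y *\<^sub>v v))"
    using v quad_form_smult[OF assms(2) v(1)] by simp
  then show ?thesis using that v by blast
qed

lemma gen_spectrum_pos:
  assumes X: "sym_pos_def n X" and Y: "sym_pos_def n Y" and "x \<in> gen_spectrum X Y"
  shows "0 < x"
proof -
  have c: "X \<in> carrier_mat n n" "Y \<in> carrier_mat n n" using X Y by (auto simp: sym_pos_def_def)
  obtain v where v: "v \<in> carrier_vec n" "v \<noteq> 0\<^sub>v n" "v \<bullet> (X *\<^sub>v v) = x * (v \<bullet> (Y *\<^sub>v v))"
    using gen_spectrum_vector[OF c assms(3)] by blast
  then have "0 < x * (v \<bullet> (Y *\<^sub>v v))" "0 < v \<bullet> (Y *\<^sub>v v)"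
    using X Y by (auto simp: sym_pos_def_def)
  then show ?thesis by (simp add: zero_less_mult_iff)
qed

lemma gen_spectrum_le_1:
  assumes Y: "sym_pos_def n Y" and XY: "loewner_le n X Y" and "x \<in> gen_spectrum X Y"
  shows "x \<le> 1"
proof -
  have c: "X \<in> carrier_mat n n" "Y \<in> carrier_mat n n" using XY by (auto simp: loewner_le_def)
  obtain v where v: "v \<in> carrier_vec n" "v \<noteq> 0\<^sub>v n" "v \<bullet> (X *\<^sub>v v) = x * (v \<bullet> (Y *\<^sub>v v))"
    using gen_spectrum_vector[OF c assms(3)] by blast
  then have "x * (v \<bullet> (Y *\<^sub>v v)) \<le> 1 * (v \<bullet> (Y *\<^sub>v v))" "0 < v \<bullet> (Y *\<^sub>v v)"
    using loewner_le_quad_form[OF XY v(1)] Y by (auto simp: sym_pos_def_def)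
  then show ?thesis by (rule mult_right_le_imp_le)
qed

lemma sorted_gen_eigenvalues: "sorted (gen_eigenvalues X Y)"
  by (simp add: gen_eigenvalues_def)

text \<open>One half of the Courant-Fischer principle, for two pencils at once. Requiring that the coordinates
  before the \<open>k\<close>th vanish in the eigenbasis of \<open>(X, Y')\<close>, and those after the \<open>k\<close>th in the eigenbasis of
  \<open>(X, Y)\<close>, imposes \<open>n - 1\<close> linear conditions, so some \<open>v \<noteq> 0\<close> satisfies them; for this \<open>v\<close> the form
  of \<open>X\<close> is at least \<open>\<lambda>\<^sub>k(X, Y')\<close> times that of \<open>Y'\<close>, and at most \<open>\<lambda>\<^sub>k(X, Y)\<close> times that of \<open>Y\<close>.
  Positivity of \<open>X\<close> ensures \<open>\<lambda>\<^sub>k(X, Y) \<ge> 0\<close>, so that \<open>Y\<close> may be replaced by \<open>Y'\<close> in the upper bound.\<close>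

lemma gen_eigenvalue_antimono:
  assumes X: "sym_pos_def n X" and Y: "sym_pos_def n Y" and YY': "loewner_le n Y Y'"
    and k: "k \<in> {1..n}"
  shows "gen_eigenvalue k X Y' \<le> gen_eigenvalue k X Y"
proof -
  have Y': "sym_pos_def n Y'" using sym_pos_def_mono[OF Y YY'] .
  have Xc: "X \<in> carrier_mat n n" "sym_mat X" using X by (auto simp: sym_pos_def_def)
  define m where "m = k - 1"
  have m: "m < n" using k by (auto simp: m_def)
  let ?d = "gen_eigenvalues X Y" and ?d' = "gen_eigenvalues X Y'"
  have len: "length ?d = n" "length ?d' = n"
    using length_gen_eigenvalues[OF Xc] Y Y' by auto
  obtain W where W: "W \<in> carrier_mat n n"
    "\<And>v. v \<in> carrier_vec n \<Longrightarrow> v \<bullet> (Y *\<^sub>v v) = (\<Sum>i<n. ((W *\<^sub>v v) $ i)\<^sup>2)"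
    "\<And>v. v \<in> carrier_vec n \<Longrightarrow> v \<bullet> (X *\<^sub>v v) = (\<Sum>i<n. ?d ! i * ((W *\<^sub>v v) $ i)\<^sup>2)"
    using simultaneous_diagonalization[OF Xc Y] by blast
  obtain W' where W': "W' \<in> carrier_mat n n"
    "\<And>v. v \<in> carrier_vec n \<Longrightarrow> v \<bullet> (Y' *\<^sub>v v) = (\<Sum>i<n. ((W' *\<^sub>v v) $ i)\<^sup>2)"
    "\<And>v. v \<in> carrier_vec n \<Longrightarrow> v \<bullet> (X *\<^sub>v v) = (\<Sum>i<n. ?d' ! i * ((W' *\<^sub>v v) $ i)\<^sup>2)"
    using simultaneous_diagonalization[OF Xc Y'] by blast
  \<comment> \<open>The linear conditions on \<open>v\<close>, padded by a zero row to a square and hence singular matrix.\<close>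
  define T where "T = mat n n (\<lambda>(i, j).
    if i < m then W' $$ (i, j) else if i = m then 0 else W $$ (i, j))"
  have T: "T \<in> carrier_mat n n" by (simp add: T_def)
  have "det T = 0"
    using laplace_expansion_row[OF T m] m by (simp add: T_def)
  then obtain v where v: "v \<in> carrier_vec n" "v \<noteq> 0\<^sub>v n" and Tv: "T *\<^sub>v v = 0\<^sub>v n"
    using det_0_iff_vec_prod_zero_field[OF T] by blast
  have low: "(W' *\<^sub>v v) $ i = 0" if "i < m" for i
    using arg_cong[OF Tv, of "\<lambda>w. w $ i"] that m v W'(1) by (simp add: T_def scalar_prod_def)
  have high: "(W *\<^sub>v v) $ i = 0" if "m < i" "i < n" for i
    using arg_cong[OF Tv, of "\<lambda>w. w $ i"] that v W(1) by (simp add: T_def scalar_prod_def)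
  have "?d' ! m * (v \<bullet> (Y' *\<^sub>v v)) \<le> v \<bullet> (X *\<^sub>v v)"
    unfolding W'(2,3)[OF v(1)] sum_distrib_left
  proof (rule sum_mono)
    fix i assume "i \<in> {..<n}"
    then show "?d' ! m * ((W' *\<^sub>v v) $ i)\<^sup>2 \<le> ?d' ! i * ((W' *\<^sub>v v) $ i)\<^sup>2"
      using low sorted_nth_mono[OF sorted_gen_eigenvalues, of m i X Y'] len
      by (cases "i < m") (auto intro: mult_right_mono)
  qed
  also have "\<dots> \<le> ?d ! m * (v \<bullet> (Y *\<^sub>v v))"
    unfolding W(2,3)[OF v(1)] sum_distrib_left
  proof (rule sum_mono)
    fix i assume "i \<in> {..<n}"
    then show "?d ! i * ((W *\<^sub>v v) $ i)\<^sup>2 \<le> ?d ! m * ((W *\<^sub>v v) $ i)\<^sup>2"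
      using high sorted_nth_mono[OF sorted_gen_eigenvalues, of i m X Y] len m
      by (cases "m < i") (auto intro: mult_right_mono)
  qed
  also have "\<dots> \<le> ?d ! m * (v \<bullet> (Y' *\<^sub>v v))"
  proof (rule mult_left_mono[OF loewner_le_quad_form[OF YY' v(1)]])
    have "?d ! m \<in> gen_spectrum X Y"
      unfolding gen_spectrum_eq_gen_eigenvalues[OF Xc(1) Y] using m len by simp
    then show "0 \<le> ?d ! m" using gen_spectrum_pos[OF X Y] by (simp add: less_imp_le)
  qed
  finally have "?d' ! m \<le> ?d ! m"
    using Y' v unfolding sym_pos_def_def by (metis mult_right_le_imp_le)
  then show ?thesis by (simp add: gen_eigenvalue_def m_def)
qed


section \<open>The eigenvalue 1\<close>

lemma one_in_gen_spectrum:
  assumes "X \<in> carrier_mat N N" "Y \<in> carrier_mat N N" "0 < N"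
    and rows: "\<And>k. k < N \<Longrightarrow> (\<Sum>l<N. X $$ (k, l)) = (\<Sum>l<N. Y $$ (k, l))"
  shows "1 \<in> gen_spectrum X Y"
proof -
  let ?e = "vec N (\<lambda>_. 1 :: real)"
  have c: "X - 1 \<cdot>\<^sub>m Y \<in> carrier_mat N N" by (rule minus_carrier_mat) (use assms in simp)
  have "(X - 1 \<cdot>\<^sub>m Y) *\<^sub>v ?e = 0\<^sub>v N"
  proof (rule eq_vecI)
    fix k assume "k < dim_vec (0\<^sub>v N :: real vec)"
    then have k: "k < N" by simp
    have "((X - 1 \<cdot>\<^sub>m Y) *\<^sub>v ?e) $ k = (\<Sum>l<N. X $$ (k, l) - Y $$ (k, l))"
      using assms(1,2) k by (auto simp: scalar_prod_def lessThan_atLeast0 intro!: sum.cong)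
    then show "((X - 1 \<cdot>\<^sub>m Y) *\<^sub>v ?e) $ k = 0\<^sub>v N $ k"
      using rows[OF k] k by (simp add: sum_subtractf)
  qed (use assms(2) in simp)
  moreover have "?e \<noteq> 0\<^sub>v N"
    using assms(3) by (metis index_vec index_zero_vec(1) zero_neq_one)
  ultimately show ?thesis
    unfolding gen_spectrum_def using det_0_iff_vec_prod_zero_field[OF c] vec_carrier by blast
qed

lemma kronecker_mat_row_sum:
  assumes A: "A \<in> carrier_mat n n" and B: "B \<in> carrier_mat m m" and k: "k < n * m"
  shows "(\<Sum>l<n * m. kronecker_mat A B $$ (k, l)) =
    (\<Sum>i<n. A $$ (k div m, i)) * (\<Sum>j<m. B $$ (k mod m, j))"
  unfolding sum_blocks sum_product
  by (intro sum.cong refl) (simp add: kronecker_mat_index[OF A B k] block_index_less)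

lemma gen_eigenvalue_last_eq_1:
  assumes X: "X \<in> carrier_mat N N" "sym_mat X" and Y: "sym_pos_def N Y"
    and le: "gen_spectrum X Y \<subseteq> {..1}" and one: "1 \<in> gen_spectrum X Y"
  shows "gen_eigenvalue N X Y = 1"
proof -
  have S: "gen_spectrum X Y = set (gen_eigenvalues X Y)"
    by (rule gen_spectrum_eq_gen_eigenvalues[OF X(1) Y])
  have len: "length (gen_eigenvalues X Y) = N"
    by (rule length_gen_eigenvalues[OF X Y])
  obtain i where i: "i < N" "gen_eigenvalues X Y ! i = 1"
    using one len unfolding S in_set_conv_nth by auto
  have "gen_eigenvalues X Y ! i \<le> gen_eigenvalues X Y ! (N - 1)"
    using i len by (intro sorted_nth_mono sorted_gen_eigenvalues) auto
  moreover have "gen_eigenvalues X Y ! (N - 1) \<in> gen_spectrum X Y"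
    unfolding S using i len by simp
  ultimately show ?thesis using i le by (auto simp: gen_eigenvalue_def)
qed


section \<open>The Kronecker product preconditioners\<close>

theorem theorem3p26:
  fixes n :: nat and B B\<^sub>1 B\<^sub>2 :: "real mat" and P :: "nat \<Rightarrow> nat \<Rightarrow> real mat"
  assumes "sym_pos_def n B\<^sub>1" and "sym_pos_def n B\<^sub>2"
    and "B = kronecker_mat B\<^sub>1 B\<^sub>2"
    and "\<And>i j. i \<in> {1..n} \<Longrightarrow> j \<in> {1..n} \<Longrightarrow> P i j = kron_preconditioner B\<^sub>1 B\<^sub>2 i j"
  shows "(\<forall>i\<in>{1..n}. \<forall>j\<in>{1..n}. gen_spectrum B (P i j) \<subseteq> {0<..1}) \<and>
    (\<forall>i\<in>{1..n}. \<forall>j\<in>{1..n}. \<forall>s\<in>{1..n}. \<forall>q\<in>{1..n}. i \<ge> s \<longrightarrow> j \<ge> q \<longrightarrow>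
       (\<forall>k\<in>{1..n^2}. gen_eigenvalue k B (P s q) \<le> gen_eigenvalue k B (P i j))) \<and>
    (nonneg_mat B\<^sub>1 \<and> nonneg_mat B\<^sub>2 \<longrightarrow>
       (\<forall>i\<in>{1..n}. \<forall>j\<in>{1..n}. gen_eigenvalue (n^2) B (P i j) = 1))"
proof -
  have c1: "B\<^sub>1 \<in> carrier_mat n n" "sym_mat B\<^sub>1" and c2: "B\<^sub>2 \<in> carrier_mat n n" "sym_mat B\<^sub>2"
    using assms(1,2) by (auto simp: sym_pos_def_def)
  have B: "sym_pos_def (n\<^sup>2) B"
    using sym_pos_def_kronecker[OF assms(1,2)] assms(3) by (simp add: power2_eq_square)
  then have Bc: "B \<in> carrier_mat (n\<^sup>2) (n\<^sup>2)" "sym_mat B" by (auto simp: sym_pos_def_def)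
  have spd: "sym_pos_def n (preconditioner i C)" if "sym_pos_def n C" "i \<le> n" for i C
  proof (rule sym_pos_def_mono[OF that(1)])
    have "C \<in> carrier_mat n n" "sym_mat C" using that(1) by (auto simp: sym_pos_def_def)
    from preconditioner_antimono[OF this that(2)] show "loewner_le n C (preconditioner i C)"
      by (simp add: preconditioner_full[OF \<open>C \<in> carrier_mat n n\<close>])
  qed
  have P: "P i j = kronecker_mat (preconditioner i B\<^sub>1) (preconditioner j B\<^sub>2)"
    if "i \<in> {1..n}" "j \<in> {1..n}" for i j
    using assms(4)[OF that] by (simp add: kron_preconditioner_def)
  have Pspd: "sym_pos_def (n\<^sup>2) (P i j)" if "i \<in> {1..n}" "j \<in> {1..n}" for i j
    using sym_pos_def_kronecker[OF spd[OF assms(1), of i] spd[OF assms(2), of j]] that P[OF that]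
    by (simp add: power2_eq_square)
  have Pmono: "loewner_le (n\<^sup>2) (P i j) (P s q)"
    if "i \<in> {1..n}" "j \<in> {1..n}" "s \<in> {1..n}" "q \<in> {1..n}" "s \<le> i" "q \<le> j" for i j s q
    using that loewner_le_kronecker[OF preconditioner_antimono[OF c1 that(5)]
        preconditioner_antimono[OF c2 that(6)]
        sym_pos_def_imp_pos_semidef[OF spd[OF assms(1)]]
        sym_pos_def_imp_pos_semidef[OF spd[OF assms(2)]]]
    by (simp add: P power2_eq_square)
  have BP: "loewner_le (n\<^sup>2) B (P i j)" if "i \<in> {1..n}" "j \<in> {1..n}" for i j
  proof -
    have n: "n \<in> {1..n}" using that by simp
    have "P n n = B" by (simp add: P[OF n n] preconditioner_full c1 c2 assms(3))
    then show ?thesis using Pmono[OF n n that] that by simp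
  qed
  have spectrum: "gen_spectrum B (P i j) \<subseteq> {0<..1}" if "i \<in> {1..n}" "j \<in> {1..n}" for i j
    using gen_spectrum_pos[OF B Pspd[OF that]] gen_spectrum_le_1[OF Pspd[OF that] BP[OF that]]
    by auto
  have mono: "gen_eigenvalue k B (P s q) \<le> gen_eigenvalue k B (P i j)"
    if "i \<in> {1..n}" "j \<in> {1..n}" "s \<in> {1..n}" "q \<in> {1..n}" "s \<le> i" "q \<le> j" "k \<in> {1..n\<^sup>2}"
    for i j s q k
    using gen_eigenvalue_antimono[OF B Pspd[OF that(1,2)] Pmono[OF that(1-6)] that(7)] .
  have top: "gen_eigenvalue (n\<^sup>2) B (P i j) = 1"
    if nn: "nonneg_mat B\<^sub>1" "nonneg_mat B\<^sub>2" and ij: "i \<in> {1..n}" "j \<in> {1..n}" for i j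
  proof (rule gen_eigenvalue_last_eq_1[OF Bc Pspd[OF ij]])
    show "gen_spectrum B (P i j) \<subseteq> {..1}" using spectrum[OF ij] by auto
    have Pc: "P i j \<in> carrier_mat (n\<^sup>2) (n\<^sup>2)" using Pspd[OF ij] by (simp add: sym_pos_def_def)
    have "(\<Sum>l<n\<^sup>2. B $$ (k, l)) = (\<Sum>l<n\<^sup>2. P i j $$ (k, l))" if "k < n\<^sup>2" for k
    proof -
      have k: "k < n * n" using that by (simp add: power2_eq_square)
      show ?thesis
        using preconditioner_row_sum[OF c1(1) nn(1) div_mod_less(1)[OF k], of i]
          preconditioner_row_sum[OF c2(1) nn(2) div_mod_less(2)[OF k], of j]
        by (simp add: assms(3) P[OF ij] power2_eq_square kronecker_mat_row_sum[OF c1(1) c2(1) k]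
            kronecker_mat_row_sum[OF preconditioner_carrier[OF c1(1)]
              preconditioner_carrier[OF c2(1)] k])
    qed
    then show "1 \<in> gen_spectrum B (P i j)"
      using ij by (intro one_in_gen_spectrum[OF Bc(1) Pc]) auto
  qed
  show ?thesis using spectrum mono top by blast
qed

end
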